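(* For each $k\in\mathbb{N}$ let $u_k^*\in\mathcal{G}_0^{\mathbf{p}(k)}$ be a critical point of $I_0^{\mathbf{p}(k)}$ on $\Lambda_0^{\mathbf{p}(k)}$ with $I_0^{\mathbf{p}(k)}(u_k^* )=d_0^{\mathbf{p}(k)}$. Then the set $\{u_k^*\}_{k=1}^\infty$ is infinite.
   Context: Let $n,r\in\mathbb{N}=\{1,2,\dots\}$. For $\mathbf{i}\in\mathbb{Z}^n$ put $\|\mathbf{i}\|=\sum_{j=1}^n|\mathbf{i}_j|$ and $B=\{\mathbf{k}\in\mathbb{Z}^n:\|\mathbf{k}\|\le r\}$. Let $s\in C^2(\mathbb{R}^B,\mathbb{R})$ satisfy: (S1) $s(u+1_B)=s(u)$, $1_B$ being the constant function $1$ on $B$; (S2) $s$ is bounded from below and $\lim_{|u(\mathbf{k})-u(\mathbf{j})|\to\infty}s(u)=\infty$ for all $\mathbf{k},\mathbf{j}\in B$ with $\|\mathbf{k}-\mathbf{j}\|=1$; (S3) $\partial_{\mathbf{k},\mathbf{j}}s\le 0$ for $\mathbf{k},\mathbf{j}\in B$, $\mathbf{k}\ne\mathbf{j}$, and $\partial_{\mathbf{0},\mathbf{j}}s<0$ for $\|\mathbf{j}\|=1$; (S4) there is a constant $C$ with $|\partial_{\mathbf{i},\mathbf{k}}s|\le C$ for all $\mathbf{i},\mathbf{k}\in B$. For $u:\mathbb{Z}^n\to\mathbb{R}$ and $\mathbf{j}\in\mathbb{Z}^n$ let $S_{\mathbf{j}}(u)=s\big((u(\mathbf{j}+\mathbf{k}))_{\mathbf{k}\in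 B}\big)$. Inequalities $<,\le$ between functions are pointwise at every point of $\mathbb{Z}^n$. Let $c_0$ be the infimum of $S_{\mathbf{0}}$ over the constant functions on $\mathbb{Z}^n$ and $\mathcal{M}_0$ the set of constant functions $u$ with $S_{\mathbf{0}}(u)=c_0$. Assume there are $v_0,w_0\in\mathcal{M}_0$ with $v_0<w_0$ that are adjacent, i.e. there is no $u\in\mathcal{M}_0$ with $v_0<u<w_0$; fix such $v_0,w_0$. For $\mathbf{p}\in\mathbb{N}^n$ let $\Lambda_0^{\mathbf{p}}$ be the space of $u:\mathbb{Z}^n\to\mathbb{R}$ with $u(\mathbf{i}+\mathbf{p}_j\mathbf{e}_j)=u(\mathbf{i})$ for all $\mathbf{i}$ and $1\le j\le n$ ($\mathbf{e}_j$ the standard basis), let $\mathbb{T}_0^{\mathbf{p}}=\prod_{j=1}^n\{0,\dots,\mathbf{p}_j-1\}$ and $\|u\|_{\Lambda_0^{\mathbf{p}}}^2=\sum_{\mathbf{j}\in\mathbb{T}_0^{\mathbf{p}}}|u(\mathbf{j})|^2$. Put $J_0^{\mathbf{p}}(u)=\sum_{\mathbf{j}\in\mathbb{T}_0^{\mathbf{p}}}S_{\mathbf{j}}(u)$ and $I_0^{\mathbf{p}}(u)=J_0^{\mathbf{p}}(u+v_0)$ for $u\in\Lambda_0^{\mathbf{p}}$. Let $\mathcal{G}_0^{\mathbf{p}}=\{u\in\Lambda_0^{\mathbf{p}}:0\le u\le w_0-v_0\}$, $\mathcal{H}_0^{\mathbf{p}}=\{h\in C([0,1],\mathcal{G}_0^{\mathbf{p}}):h(0)=0,\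 h(1)=w_0-v_0\}$ and $d_0^{\mathbf{p}}=\inf_{h\in\mathcal{H}_0^{\mathbf{p}}}\max_{\theta\in[0,1]}I_0^{\mathbf{p}}(h(\theta))$. Put $\mathbf{p}(k)=(k,1,\dots,1)\in\mathbb{N}^n$. (Critical points $u_k^*$ as in the claim exist for every $k$.) *)

theory Defs
  imports "HOL-Analysis.Analysis" "HOL-Library.Function_Algebras"
begin

type_synonym 'n lattice = "int ^ 'n"
type_synonym 'n config = "'n lattice \<Rightarrow> real"

definition l1norm :: "'n::finite lattice \<Rightarrow> int" where
  "l1norm i = (\<Sum>j\<in>UNIV. \<bar>i $ j\<bar>)"

definition Bset :: "nat \<Rightarrow> 'n::finite lattice set" where
  "Bset r = {k. l1norm k \<le> int r}"

text \<open>The range \<open>r\<close> is a term, so \<open>\<real>\<^sup>B\<close> is not a type of its own: its elements are the functions on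
  the whole lattice that are \<open>undefined\<close> off the finite set \<open>B\<close>. The product topology of the
  function type induces the Euclidean topology on it, and \<open>u(k := t)\<close> stays in it for \<open>k \<in> B\<close>.\<close>

definition RB :: "nat \<Rightarrow> 'n::finite config set" where
  "RB r = Bset r \<rightarrow>\<^sub>E UNIV"

definition partial :: "'n::finite lattice \<Rightarrow> ('n config \<Rightarrow> real) \<Rightarrow> 'n config \<Rightarrow> real" where
  "partial k f u = deriv (\<lambda>t. f (u(k := t))) (u k)"

text \<open>\<open>Ck_on_RB r m f\<close>: \<open>f\<close> is of class \<open>C\<^sup>m\<close> on \<open>\<real>\<^sup>B\<close>, i.e. all its iterated partial derivatives up to
  order \<open>m\<close> exist and are continuous.\<close>

primrec Ck_on_RB :: "nat \<Rightarrow> nat \<Rightarrow> ('n::finite config \<Rightarrow> real) \<Rightarrow> bool" where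
  "Ck_on_RB r 0 f \<longleftrightarrow> continuous_on (RB r) f"
| "Ck_on_RB r (Suc m) f \<longleftrightarrow> continuous_on (RB r) f \<and>
     (\<forall>k\<in>Bset r. (\<forall>u\<in>RB r. (\<lambda>t. f (u(k := t))) differentiable (at (u k)))
                  \<and> Ck_on_RB r m (partial k f))"

definition shift_invariant :: "nat \<Rightarrow> ('n::finite config \<Rightarrow> real) \<Rightarrow> bool" where
  "shift_invariant r s \<longleftrightarrow> (\<forall>u\<in>RB r. s (\<lambda>k\<in>Bset r. u k + 1) = s u)"

definition coercive :: "nat \<Rightarrow> ('n::finite config \<Rightarrow> real) \<Rightarrow> bool" where
  "coercive r s \<longleftrightarrow> bdd_below (s ` RB r) \<and>
     (\<forall>k\<in>Bset r. \<forall>j\<in>Bset r. l1norm (k - j) = 1 \<longrightarrow>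
        filterlim s at_top (inf (filtercomap (\<lambda>u. \<bar>u k - u j\<bar>) at_top) (principal (RB r))))"

definition twist_condition :: "nat \<Rightarrow> ('n::finite config \<Rightarrow> real) \<Rightarrow> bool" where
  "twist_condition r s \<longleftrightarrow>
     (\<forall>u\<in>RB r. \<forall>k\<in>Bset r. \<forall>j\<in>Bset r. k \<noteq> j \<longrightarrow> partial k (partial j s) u \<le> 0) \<and>
     (\<forall>u\<in>RB r. \<forall>j. l1norm j = 1 \<longrightarrow> partial 0 (partial j s) u < 0)"

definition bounded_second_partials :: "nat \<Rightarrow> ('n::finite config \<Rightarrow> real) \<Rightarrow> bool" where
  "bounded_second_partials r s \<longleftrightarrow>
     (\<exists>C. \<forall>u\<in>RB r. \<forall>i\<in>Bset r. \<forall>k\<in>Bset r. \<bar>partial i (partial k s) u\<bar> \<le> C)"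

definition S_site :: "nat \<Rightarrow> ('n::finite config \<Rightarrow> real) \<Rightarrow> 'n lattice \<Rightarrow> 'n config \<Rightarrow> real" where
  "S_site r s j u = s (\<lambda>k\<in>Bset r. u (j + k))"

text \<open>The order \<open><\<close> of the function type only requires strictness at some point.\<close>

definition pointwise_less :: "'n::finite config \<Rightarrow> 'n config \<Rightarrow> bool" where
  "pointwise_less u v \<longleftrightarrow> (\<forall>i. u i < v i)"

definition constants :: "'n::finite config set" where
  "constants = {u. \<exists>c. u = (\<lambda>_. c)}"

definition c0 :: "nat \<Rightarrow> ('n::finite config \<Rightarrow> real) \<Rightarrow> real" where
  "c0 r s = (INF u\<in>constants. S_site r s 0 u)"

definition M0 :: "nat \<Rightarrow> ('n::finite config \<Rightarrow> real) \<Rightarrow> 'n config set" where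
  "M0 r s = {u \<in> constants. S_site r s 0 u = c0 r s}"

definition Lambda0 :: "nat ^ 'n \<Rightarrow> 'n::finite config set" where
  "Lambda0 p = {u. \<forall>i j. u (i + int (p $ j) *s axis j 1) = u i}"

definition T0 :: "nat ^ 'n \<Rightarrow> 'n::finite lattice set" where
  "T0 p = {i. \<forall>j. i $ j \<in> {0..<int (p $ j)}}"

definition Lnorm :: "nat ^ 'n \<Rightarrow> 'n::finite config \<Rightarrow> real" where
  "Lnorm p u = sqrt (\<Sum>j\<in>T0 p. \<bar>u j\<bar>\<^sup>2)"

definition J0 :: "nat \<Rightarrow> ('n::finite config \<Rightarrow> real) \<Rightarrow> nat ^ 'n \<Rightarrow> 'n config \<Rightarrow> real" where
  "J0 r s p u = (\<Sum>j\<in>T0 p. S_site r s j u)"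

definition I0 :: "nat \<Rightarrow> ('n::finite config \<Rightarrow> real) \<Rightarrow> 'n config \<Rightarrow> nat ^ 'n \<Rightarrow> 'n config \<Rightarrow> real" where
  "I0 r s v0 p u = J0 r s p (u + v0)"

definition G0 :: "'n::finite config \<Rightarrow> 'n config \<Rightarrow> nat ^ 'n \<Rightarrow> 'n config set" where
  "G0 v0 w0 p = {u \<in> Lambda0 p. 0 \<le> u \<and> u \<le> w0 - v0}"

definition H0 :: "'n::finite config \<Rightarrow> 'n config \<Rightarrow> nat ^ 'n \<Rightarrow> (real \<Rightarrow> 'n config) set" where
  "H0 v0 w0 p = {h. h ` {0..1} \<subseteq> G0 v0 w0 p \<and>
      (\<forall>\<theta>\<in>{0..1}. ((\<lambda>t. Lnorm p (h t - h \<theta>)) \<longlongrightarrow> 0) (at \<theta> within {0..1})) \<and>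
      h 0 = 0 \<and> h 1 = w0 - v0}"

text \<open>The maximum of \<open>I0 \<circ> h\<close> over \<open>[0,1]\<close> is written as a supremum; it is attained for continuous \<open>s\<close>.\<close>

definition d0 :: "nat \<Rightarrow> ('n::finite config \<Rightarrow> real) \<Rightarrow> 'n config \<Rightarrow> 'n config \<Rightarrow> nat ^ 'n \<Rightarrow> real" where
  "d0 r s v0 w0 p = (INF h\<in>H0 v0 w0 p. SUP \<theta>\<in>{0..1}. I0 r s v0 p (h \<theta>))"

text \<open>Frechet derivative on the normed space \<open>Lambda0 p\<close>, which is a set and not a type. It is
  finite-dimensional, so boundedness of the linear functional need not be demanded.\<close>

definition has_Frechet_derivative_on_Lambda0 ::
    "nat ^ 'n \<Rightarrow> ('n::finite config \<Rightarrow> real) \<Rightarrow> ('n config \<Rightarrow> real) \<Rightarrow> 'n config \<Rightarrow> bool" where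
  "has_Frechet_derivative_on_Lambda0 p F L u \<longleftrightarrow>
     (\<forall>\<phi>\<in>Lambda0 p. \<forall>\<psi>\<in>Lambda0 p. L (\<phi> + \<psi>) = L \<phi> + L \<psi>) \<and>
     (\<forall>\<phi>\<in>Lambda0 p. \<forall>a::real. L (\<lambda>i. a * \<phi> i) = a * L \<phi>) \<and>
     ((\<lambda>\<phi>. (F (u + \<phi>) - F u - L \<phi>) / Lnorm p \<phi>) \<longlongrightarrow> 0)
       (inf (filtercomap (Lnorm p) (at_right 0)) (principal (Lambda0 p)))"

definition critical_point :: "nat ^ 'n \<Rightarrow> ('n::finite config \<Rightarrow> real) \<Rightarrow> 'n config \<Rightarrow> bool" where
  "critical_point p F u \<longleftrightarrow> u \<in> Lambda0 p \<and> has_Frechet_derivative_on_Lambda0 p F (\<lambda>_. 0) u"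

text \<open>\<open>(k,1,\<dots>,1)\<close>, where \<open>e\<close> is the index regarded as the first one: a bare finite index type carries no
  order, so any of its elements may play that role.\<close>

definition pvec :: "'n::finite \<Rightarrow> nat \<Rightarrow> nat ^ 'n" where
  "pvec e k = (\<chi> j. if j = e then k else 1)"

end

theory Submission
  imports Defs
begin

text \<open>
The idea is that the mountain pass level \<open>d(k)\<close> of period \<open>(k,1,\<dots>,1)\<close> exceeds the minimal energy
\<open>k c\<^sub>0\<close> by an amount that is positive and bounded in \<open>k\<close>:
\<open>k c\<^sub>0 + \<delta> \<le> d(k) \<le> k c\<^sub>0 + C\<close> with \<open>\<delta> > 0\<close> and \<open>C\<close> independent of \<open>k\<close>. If the set of the
\<open>u\<^sub>k\<^sup>*\<close> were finite, one configuration \<open>u\<close> would be \<open>u\<^sub>k\<^sup>*\<close> for infinitely many \<open>k\<close>. Its energy per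
site does not depend on the period used to compute it, so \<open>d(k) = k d(l) / l\<close> for all these \<open>k\<close> and one
fixed \<open>l\<close> among them. The excess \<open>d(k) - k c\<^sub>0\<close> then grows at least like \<open>k \<delta> / l\<close>, contrary to the
upper bound.

Upper bound (\<open>J0_sweep_le\<close>): replace \<open>v\<^sub>0\<close> by \<open>w\<^sub>0\<close> site by site along the first direction. At each time
the configuration equals \<open>v\<^sub>0\<close> or \<open>w\<^sub>0\<close> on the whole window of a site unless the site is within distance
\<open>r\<close> of one of the two fronts. So all but at most \<open>4r+1\<close> sites carry the energy \<open>c\<^sub>0\<close>, and the others
carry a bounded energy.

Lower bound (\<open>J0_ge_sum_const_energy\<close>): condition (S3) makes the local energy submodular. Take the \<open>k\<close>
translates of a configuration \<open>u\<close> of period \<open>(k,1,\<dots>,1)\<close>. Replacing two configurations by their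
meet and join does not raise the sum of their local energies, and finitely many such
replacements sort the values of the translates at every site simultaneously. Translation only permutes
the values of \<open>u\<close>, so the sorted values are the same at every site: sorting turns the translates into
constants. Hence the energy of \<open>u\<close> is at least the sum, over the \<open>k\<close> sites of a period, of the energy of
the constant with the value of \<open>u\<close> there. A path from \<open>v\<^sub>0\<close> to \<open>w\<^sub>0\<close> passes a configuration whose value
at the origin is midway, and there the corresponding constant is not a minimizer because \<open>v\<^sub>0\<close> and
\<open>w\<^sub>0\<close> are adjacent; its excess energy is \<open>\<delta>\<close>.
\<close>

section \<open>Submodular functions and sorting\<close>

definition submodular :: "(('a \<Rightarrow> real) \<Rightarrow> real) \<Rightarrow> bool" where
  "submodular F \<longleftrightarrow> (\<forall>x y. F (inf x y) + F (sup x y) \<le> F x + F y)"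

text \<open>Insertion of \<open>x\<close> into a sorted list, done at all coordinates simultaneously: at every step the
  smaller values stay and the larger ones are carried on.\<close>

fun insert_meet_join :: "('a \<Rightarrow> real) \<Rightarrow> ('a \<Rightarrow> real) list \<Rightarrow> ('a \<Rightarrow> real) list" where
  "insert_meet_join x [] = [x]"
| "insert_meet_join x (y # ys) = inf x y # insert_meet_join (sup x y) ys"

definition sort_columns :: "('a \<Rightarrow> real) list \<Rightarrow> ('a \<Rightarrow> real) list" where
  "sort_columns xs = foldr insert_meet_join xs []"

lemma sorted_column_insert:
  "sorted (map (\<lambda>z. z b) ys) \<Longrightarrow>
     sorted (map (\<lambda>z. z b) (insert_meet_join x ys)) \<and>
     mset (map (\<lambda>z. z b) (insert_meet_join x ys)) = add_mset (x b) (mset (map (\<lambda>z. z b) ys))"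
proof (induction ys arbitrary: x)
  case (Cons y ys)
  let ?zs = "insert_meet_join (sup x y) ys"
  have "sorted (map (\<lambda>z. z b) ?zs) \<and>
      mset (map (\<lambda>z. z b) ?zs) = add_mset ((sup x y) b) (mset (map (\<lambda>z. z b) ys))"
    by (rule Cons.IH) (use Cons.prems in simp)
  then have IH: "sorted (map (\<lambda>z. z b) ?zs)"
    "mset (map (\<lambda>z. z b) ?zs) = add_mset (max (x b) (y b)) (mset (map (\<lambda>z. z b) ys))"
    by (simp_all add: sup_max)
  have "set (map (\<lambda>z. z b) ?zs) = insert (max (x b) (y b)) (set (map (\<lambda>z. z b) ys))"
    using IH(2) by (metis set_mset_add_mset_insert set_mset_mset)
  then have "\<forall>a\<in>set (map (\<lambda>z. z b) ?zs). min (x b) (y b) \<le> a"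
    using Cons.prems by auto
  then show ?case
    using IH by (auto simp: inf_min min_def max_def)
qed auto

lemma sorted_column_sort_columns:
  "sorted (map (\<lambda>z. z b) (sort_columns xs)) \<and>
   mset (map (\<lambda>z. z b) (sort_columns xs)) = mset (map (\<lambda>z. z b) xs)"
proof (induction xs)
  case (Cons x xs)
  then show ?case
    using sorted_column_insert[of b "sort_columns xs" x] by (simp add: sort_columns_def)
qed (simp add: sort_columns_def)

lemma sum_sort_columns_le:
  assumes "submodular F"
  shows "sum_list (map F (sort_columns xs)) \<le> sum_list (map F xs)"
proof -
  have ins: "sum_list (map F (insert_meet_join x ys)) \<le> F x + sum_list (map F ys)" for x ys
  proof (induction ys arbitrary: x)
    case (Cons y ys)
    have "F (inf x y) + F (sup x y) \<le> F x + F y"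
      using assms by (simp add: submodular_def)
    moreover have "sum_list (map F (insert_meet_join (sup x y) ys)) \<le> F (sup x y) + sum_list (map F ys)"
      by (rule Cons.IH)
    ultimately show ?case
      by simp
  qed simp
  show ?thesis
  proof (induction xs)
    case (Cons x xs)
    then show ?case
      using ins[of x "sort_columns xs"] by (simp add: sort_columns_def)
  qed (simp add: sort_columns_def)
qed

text \<open>If the values at every coordinate form the same multiset, then sorting each coordinate yields
  constant functions, and sorting by meets and joins does not increase the sum.\<close>

lemma submodular_sum_ge_constants:
  assumes F: "submodular F"
    and col: "\<And>b. mset (map (\<lambda>x. x b) xs) = mset as"
  shows "(\<Sum>a\<leftarrow>as. F (\<lambda>_. a)) \<le> (\<Sum>x\<leftarrow>xs. F x)"
proof -
  let ?ys = "sort_columns xs"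
  have c: "map (\<lambda>y. y b) ?ys = sort as" for b
    using sorted_column_sort_columns[of b xs] col[of b] by (metis properties_for_sort)
  have len: "length (sort as) = length ?ys"
    using c by (metis length_map)
  have "?ys = map (\<lambda>a _. a) (sort as)"
  proof (rule nth_equalityI)
    fix i assume i: "i < length ?ys"
    have "(?ys ! i) b = sort as ! i" for b
      using c[of b] i by (metis nth_map)
    then show "?ys ! i = map (\<lambda>a _. a) (sort as) ! i"
      using i len by auto
  qed (use len in simp)
  then have "(\<Sum>y\<leftarrow>?ys. F y) = (\<Sum>a\<leftarrow>sort as. F (\<lambda>_. a))"
    by (simp add: comp_def)
  also have "\<dots> = (\<Sum>a\<leftarrow>as. F (\<lambda>_. a))"
    by (metis (no_types) mset_map mset_sort sum_mset_sum_list)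
  finally show ?thesis
    using sum_sort_columns_le[OF F, of xs] by simp
qed

section \<open>The twist condition makes the local energy submodular\<close>

lemma antitone_if_antitone_in_each_coordinate:
  fixes g :: "('a \<Rightarrow> real) \<Rightarrow> real"
  assumes "finite D"
    and "\<And>z j a b. j \<in> D \<Longrightarrow> a \<le> b \<Longrightarrow> g (z(j := b)) \<le> g (z(j := a))"
    and "\<And>j. j \<in> D \<Longrightarrow> x j \<le> y j"
  shows "g (override_on z y D) \<le> g (override_on z x D)"
  using assms
proof (induction D arbitrary: z rule: finite_induct)
  case (insert j D)
  have "g (override_on z y (insert j D)) = g (override_on (z(j := y j)) y D)"
    using insert.hyps by (auto intro!: arg_cong[where f = g] simp: override_on_def)
  also have "\<dots> \<le> g (override_on (z(j := y j)) x D)"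
    using insert by simp
  also have "override_on (z(j := y j)) x D = (override_on z x D)(j := y j)"
    using insert.hyps by (auto simp: override_on_def)
  also have "g \<dots> \<le> g ((override_on z x D)(j := x j))"
    by (rule insert.prems(1)) (use insert.prems(2) in auto)
  also have "(override_on z x D)(j := x j) = override_on z x (insert j D)"
    by (auto simp: override_on_def)
  finally show ?case .
qed simp

lemma nth_le_l1norm: "\<bar>i $ j\<bar> \<le> l1norm i"
  unfolding l1norm_def by (rule member_le_sum) auto

lemma finite_Bset: "finite (Bset r :: 'n::finite lattice set)"
proof -
  have "Bset r \<subseteq> vec_lambda ` (PiE UNIV (\<lambda>_. {- int r..int r}) :: ('n \<Rightarrow> int) set)"
  proof
    fix k :: "'n lattice" assume "k \<in> Bset r"
    then have "\<bar>k $ j\<bar> \<le> int r" for j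
      using nth_le_l1norm[of k j] by (simp add: Bset_def)
    then have "vec_nth k \<in> PiE UNIV (\<lambda>_. {- int r..int r})"
      by (auto simp: abs_le_iff) (metis minus_le_iff)
    then show "k \<in> vec_lambda ` PiE UNIV (\<lambda>_. {- int r..int r})"
      by (metis image_eqI vec_nth_inverse)
  qed
  then show ?thesis
    by (rule finite_subset) (intro finite_imageI finite_PiE; simp)
qed

lemma has_derivative_partial:
  assumes "Ck_on_RB r (Suc m) f" and k: "k \<in> Bset r"
  shows "((\<lambda>t. f (restrict (z(k := t)) (Bset r))) has_real_derivative
          partial k f (restrict (z(k := t)) (Bset r))) (at t)"
proof -
  define u where "u = restrict (z(k := t)) (Bset r)"
  have "u \<in> RB r"
    by (simp add: u_def RB_def)
  then have "(\<lambda>t. f (u(k := t))) differentiable (at (u k))"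
    using assms by simp
  moreover have "u(k := t') = restrict (z(k := t')) (Bset r)" for t'
    using k by (auto simp: u_def)
  moreover have "u k = t"
    using k by (simp add: u_def)
  ultimately show ?thesis
    unfolding partial_def u_def[symmetric]
    by (metis (no_types, lifting) ext DERIV_deriv_iff_real_differentiable)
qed

text \<open>The mixed second partials are nonpositive, so a partial derivative does not increase when any of the
  other coordinates is raised.\<close>

lemma partial_antitone:
  fixes x y :: "'n::finite config"
  assumes C2: "Ck_on_RB r 2 s" and tw: "twist_condition r s" and k: "k \<in> Bset r"
    and xy: "\<And>j. j \<in> Bset r \<Longrightarrow> x j \<le> y j" and eq: "x k = y k"
  shows "partial k s (restrict y (Bset r)) \<le> partial k s (restrict x (Bset r))"
proof -
  let ?g = "\<lambda>z. partial k s (restrict z (Bset r))"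
  have C1: "Ck_on_RB r (Suc 0) (partial k s)"
    using C2 k by (simp add: numeral_2_eq_2)
  have dec: "?g (z(j := b)) \<le> ?g (z(j := a))" if "j \<in> Bset r - {k}" "a \<le> b" for z j a b
  proof (rule DERIV_nonpos_imp_nonincreasing[OF that(2)])
    fix t
    have "partial j (partial k s) (restrict (z(j := t)) (Bset r)) \<le> 0"
      using tw that k by (auto simp: twist_condition_def RB_def)
    then show "\<exists>d. ((\<lambda>t. ?g (z(j := t))) has_real_derivative d) (at t) \<and> d \<le> 0"
      using has_derivative_partial[OF C1, of j z t] that by blast
  qed
  have "?g (override_on x y (Bset r - {k})) \<le> ?g (override_on x x (Bset r - {k}))"
  proof (rule antitone_if_antitone_in_each_coordinate)
    show "finite (Bset r - {k})"
      using finite_Bset by blast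
  qed (rule dec; assumption | simp add: xy)+
  moreover have "restrict (override_on x y (Bset r - {k})) (Bset r) = restrict y (Bset r)"
    using eq by (auto simp: override_on_def)
  moreover have "override_on x x (Bset r - {k}) = x"
    by (auto simp: override_on_def)
  ultimately show ?thesis
    by simp
qed

text \<open>Let \<open>D\<close> be the set of sites where \<open>x\<close> exceeds \<open>y\<close>. Off \<open>D\<close> we have \<open>x \<le> y\<close>, so the gain in energy
  from replacing \<open>x\<close> by \<open>y\<close> off \<open>D\<close> does not grow when values in \<open>D\<close> are raised, by antitonicity of the
  partials. Comparing this gain for the values of \<open>x\<close> and of \<open>y\<close> in \<open>D\<close> is submodularity.\<close>

lemma submodular_local_energy:
  fixes s :: "'n::finite config \<Rightarrow> real"
  assumes C2: "Ck_on_RB r 2 s" and tw: "twist_condition r s"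
  shows "submodular (\<lambda>u. s (restrict u (Bset r)))"
  unfolding submodular_def
proof (intro allI)
  fix x y :: "'n config"
  let ?f = "\<lambda>u. s (restrict u (Bset r))"
  define D where "D = {k \<in> Bset r. y k < x k}"
  define g where "g = (\<lambda>z. ?f (override_on y z D) - ?f (override_on x z D))"
  have C2': "Ck_on_RB r (Suc 1) s"
    using C2 by (simp add: numeral_2_eq_2)
  have dec: "g (z(j := b)) \<le> g (z(j := a))" if j: "j \<in> D" and ab: "a \<le> b" for z j a b
  proof (rule DERIV_nonpos_imp_nonincreasing[OF ab])
    fix t
    have jB: "j \<in> Bset r"
      using j by (simp add: D_def)
    let ?y = "(override_on y z D)(j := t)" and ?x = "(override_on x z D)(j := t)"
    have ov: "override_on w (z(j := t')) D = (override_on w z D)(j := t')" for w t'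
      using j by (auto simp: override_on_def)
    have "((\<lambda>t. g (z(j := t))) has_real_derivative
        partial j s (restrict ?y (Bset r)) - partial j s (restrict ?x (Bset r))) (at t)"
      unfolding g_def ov by (intro DERIV_diff has_derivative_partial[OF C2' jB])
    moreover have "partial j s (restrict ?y (Bset r)) \<le> partial j s (restrict ?x (Bset r))"
      by (rule partial_antitone[OF C2 tw jB]) (auto simp: override_on_def D_def)
    ultimately show "\<exists>d. ((\<lambda>t. g (z(j := t))) has_real_derivative d) (at t) \<and> d \<le> 0"
      by (metis diff_le_0_iff_le)
  qed
  have "g (override_on x x D) \<le> g (override_on x y D)"
  proof (rule antitone_if_antitone_in_each_coordinate)
    show "finite D"
      by (rule finite_subset[OF _ finite_Bset]) (auto simp: D_def)
  qed (rule dec; assumption | simp add: D_def)+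
  moreover have "restrict (override_on y (override_on x x D) D) (Bset r) = restrict (sup x y) (Bset r)"
    "restrict (override_on x y D) (Bset r) = restrict (inf x y) (Bset r)"
    by (auto simp: override_on_def D_def sup_max inf_min fun_eq_iff)
  moreover have "override_on x (override_on x x D) D = x" "override_on y (override_on x y D) D = y"
    "override_on x (override_on x y D) D = override_on x y D"
    by (auto simp: override_on_def)
  ultimately show "?f (inf x y) + ?f (sup x y) \<le> ?f x + ?f y"
    by (simp add: g_def)
qed

section \<open>Configurations periodic in one direction\<close>

lemma Lambda0_cong:
  fixes u :: "'n::finite config"
  assumes u: "u \<in> Lambda0 p" and ij: "\<And>l. i $ l mod int (p $ l) = j $ l mod int (p $ l)"
  shows "u i = u j"
proof -
  have step: "u (i + (m * int (p $ l)) *s axis l 1) = u i" for i l and m :: int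
  proof (induction m rule: int_induct[where k = 0])
    case (step1 m)
    have "u (i + ((m + 1) * int (p $ l)) *s axis l 1)
        = u ((i + (m * int (p $ l)) *s axis l 1) + int (p $ l) *s axis l 1)"
      by (simp add: vec.scale_left_distrib algebra_simps)
    also have "\<dots> = u (i + (m * int (p $ l)) *s axis l 1)"
      using u unfolding Lambda0_def by blast
    finally show ?case
      using step1 by simp
  next
    case (step2 m)
    have "u (i + (m * int (p $ l)) *s axis l 1)
        = u ((i + ((m - 1) * int (p $ l)) *s axis l 1) + int (p $ l) *s axis l 1)"
      by (simp add: vec.scale_left_distrib vec.scale_left_diff_distrib algebra_simps)
    also have "\<dots> = u (i + ((m - 1) * int (p $ l)) *s axis l 1)"
      using u unfolding Lambda0_def by blast
    finally show ?case
      using step2 by simp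
  qed simp
  (* Exchange the coordinates of i for those of j one at a time. *)
  have "u (\<chi> l. if l \<in> A then j $ l else i $ l) = u i" if "finite A" for A
    using that
  proof induction
    case (insert a A)
    obtain m where m: "j $ a - i $ a = int (p $ a) * m"
      using ij[of a] by (metis mod_eq_dvd_iff dvd_def)
    have "(\<chi> l. if l \<in> insert a A then j $ l else i $ l)
        = (\<chi> l. if l \<in> A then j $ l else i $ l) + (m * int (p $ a)) *s axis a 1"
      using insert.hyps m by (auto simp: vec_eq_iff axis_def algebra_simps)
    then show ?case
      using step insert.IH by simp
  qed simp
  from this[of UNIV] show ?thesis
    by simp
qed

lemma Lambda0_pvec_cong:
  fixes u :: "'n::finite config"
  assumes "u \<in> Lambda0 (pvec e k)" and "i $ e mod int k = j $ e mod int k"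
  shows "u i = u j"
  by (rule Lambda0_cong[OF assms(1)]) (use assms(2) in \<open>simp add: pvec_def\<close>)

lemma T0_pvec: "T0 (pvec e k) = (\<lambda>m. axis e (int m)) ` {..<k}" (is "?T = ?A")
proof
  show "?T \<subseteq> ?A"
  proof
    fix i assume i: "i \<in> ?T"
    have bd: "0 \<le> i $ j" "i $ j < int (pvec e k $ j)" for j
      using i by (simp_all add: T0_def)
    have e: "0 \<le> i $ e" "i $ e < int k"
      using bd[of e] by (simp_all add: pvec_def)
    have "i $ j = axis e (int (nat (i $ e))) $ j" for j
      using bd[of j] e by (cases "j = e") (simp_all add: pvec_def axis_def)
    then have "i = axis e (int (nat (i $ e)))"
      unfolding vec_eq_iff by blast
    moreover have "nat (i $ e) < k"
      using e by linarith
    ultimately show "i \<in> ?A"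
      by blast
  qed
qed (auto simp: T0_def pvec_def axis_def)

lemma J0_pvec: "J0 r s (pvec e k) u = (\<Sum>m<k. S_site r s (axis e (int m)) u)"
proof -
  have "inj_on (\<lambda>m. axis e (int m)) {..<k}"
    by (auto simp: inj_on_def axis_eq_axis)
  then show ?thesis
    by (simp add: J0_def T0_pvec sum.reindex)
qed

lemma J0_pvec_multiple:
  assumes u: "u \<in> Lambda0 (pvec e k)"
  shows "J0 r s (pvec e (l * k)) u = real l * J0 r s (pvec e k) u"
proof -
  define f where "f m = S_site r s (axis e (int m)) u" for m
  have per: "f (i + m * k) = f i" for i m
  proof -
    have "u (axis e (int (i + m * k)) + b) = u (axis e (int i) + b)" for b
    proof (rule Lambda0_pvec_cong[OF u])
      have "(axis e (int (i + m * k)) + b) $ e = (axis e (int i) + b) $ e + int m * int k"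
        by simp
      then show "(axis e (int (i + m * k)) + b) $ e mod int k = (axis e (int i) + b) $ e mod int k"
        by (simp only: mod_mult_self1)
    qed
    then show ?thesis
      by (simp add: f_def S_site_def)
  qed
  have "sum f {m * k..<m * k + k} = sum f {..<k}" for m
  proof -
    have "sum f {m * k..<m * k + k} = (\<Sum>i<k. f (i + m * k))"
      using sum.shift_bounds_nat_ivl[of f 0 "m * k" k] by (simp add: lessThan_atLeast0 add.commute)
    then show ?thesis
      by (simp add: per)
  qed
  then have "sum f {..<l * k} = real l * sum f {..<k}"
    using sum.nat_group[of f k l] by simp
  then show ?thesis
    by (simp add: J0_pvec f_def)
qed

section \<open>Energy of a periodic configuration compared with constants\<close>

definition const_energy :: "nat \<Rightarrow> ('n::finite config \<Rightarrow> real) \<Rightarrow> real \<Rightarrow> real" where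
  "const_energy r s a = S_site r s 0 (\<lambda>_. a)"

lemma c0_le_const_energy:
  assumes "coercive r s"
  shows "c0 r s \<le> const_energy r s a"
proof -
  have "bdd_below (S_site r s 0 ` constants)"
    by (rule bdd_below_mono[of "s ` RB r"]) (use assms in \<open>auto simp: coercive_def S_site_def RB_def\<close>)
  then show ?thesis
    unfolding c0_def const_energy_def by (rule cINF_lower) (auto simp: constants_def)
qed

text \<open>Submodularity is applied to the translates of \<open>u\<close> by \<open>0, \<dots>, k-1\<close> in direction \<open>e\<close>, whose local
  energies at the origin sum up to \<open>J0\<close>.\<close>

lemma J0_ge_sum_const_energy:
  fixes u :: "'n::finite config"
  assumes C2: "Ck_on_RB r 2 s" and tw: "twist_condition r s" and u: "u \<in> Lambda0 (pvec e k)"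
  shows "(\<Sum>m<k. const_energy r s (u (axis e (int m)))) \<le> J0 r s (pvec e k) u"
proof -
  define g where "g m = u (axis e (int m))" for m
  define xs where "xs = map (\<lambda>m b. u (axis e (int m) + b)) [0..<k]"
  have col: "mset (map (\<lambda>x. x b) xs) = mset (map g [0..<k])" for b
  proof -
    (* At the site b the m-th translate takes the value of u at position \<sigma> m, a permutation. *)
    define \<sigma> where "\<sigma> m = nat ((int m + b $ e) mod int k)" for m
    have "inj_on \<sigma> {0..<k}"
    proof (rule inj_onI)
      fix m m' assume mm: "m \<in> {0..<k}" "m' \<in> {0..<k}" "\<sigma> m = \<sigma> m'"
      then have "(int m + b $ e) mod int k = (int m' + b $ e) mod int k"
        by (simp add: \<sigma>_def nat_eq_iff)
      then have "int m mod int k = int m' mod int k"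
        by (simp add: mod_eq_dvd_iff)
      then show "m = m'"
        using mm by simp
    qed
    moreover have "\<sigma> ` {0..<k} \<subseteq> {0..<k}"
      by (auto simp: \<sigma>_def nat_less_iff)
    ultimately have \<sigma>: "image_mset \<sigma> (mset_set {0..<k}) = mset_set {0..<k}"
      by (simp add: image_mset_mset_set endo_inj_surj)
    have "u (axis e (int m) + b) = g (\<sigma> m)" if "m < k" for m
      unfolding g_def by (rule Lambda0_pvec_cong[OF u]) (use that in \<open>simp add: \<sigma>_def\<close>)
    then have "mset (map (\<lambda>x. x b) xs) = image_mset (\<lambda>m. g (\<sigma> m)) (mset_set {0..<k})"
      by (auto simp: xs_def comp_def intro!: image_mset_cong)
    also have "\<dots> = image_mset g (image_mset \<sigma> (mset_set {0..<k}))"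
      by (simp add: multiset.map_comp comp_def)
    finally show ?thesis
      by (simp add: \<sigma>)
  qed
  have "(\<Sum>a\<leftarrow>map g [0..<k]. s (restrict (\<lambda>_. a) (Bset r))) \<le> (\<Sum>x\<leftarrow>xs. s (restrict x (Bset r)))"
    by (rule submodular_sum_ge_constants[OF submodular_local_energy[OF C2 tw] col])
  then show ?thesis
    by (simp add: J0_pvec const_energy_def S_site_def xs_def g_def comp_def
        interv_sum_list_conv_sum_set_nat lessThan_atLeast0)
qed

lemma J0_ge_const_energy_at_0:
  fixes u :: "'n::finite config"
  assumes "Ck_on_RB r 2 s" "twist_condition r s" "coercive r s" "u \<in> Lambda0 (pvec e k)" "k \<ge> 1"
  shows "real k * c0 r s + (const_energy r s (u 0) - c0 r s) \<le> J0 r s (pvec e k) u"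
proof -
  let ?f = "\<lambda>m. const_energy r s (u (axis e (int m))) - c0 r s"
  have "axis e (int 0) = (0 :: 'n lattice)"
    by (simp add: axis_def vec_eq_iff)
  then have "const_energy r s (u 0) - c0 r s = ?f 0"
    by (simp only:)
  also have "\<dots> \<le> (\<Sum>m<k. ?f m)"
    using assms(5) c0_le_const_energy[OF assms(3)] by (intro member_le_sum) auto
  also have "\<dots> \<le> J0 r s (pvec e k) u - real k * c0 r s"
    using J0_ge_sum_const_energy[OF assms(1,2,4)] by (simp add: sum_subtractf)
  finally show ?thesis
    by simp
qed

section \<open>The energy barrier between adjacent constant minimizers\<close>

lemma path_crosses_level:
  fixes h :: "real \<Rightarrow> 'n::finite config"
  assumes h: "h \<in> H0 v0 w0 (pvec e k)" and k: "k \<ge> 1" and c: "0 \<le> c" "c \<le> w0 0 - v0 0"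
  obtains \<theta> where "\<theta> \<in> {0..1}" "h \<theta> 0 = c"
proof -
  let ?p = "pvec e k"
  have z: "0 \<in> T0 ?p"
    using k by (simp add: T0_def pvec_def)
  have fin: "finite (T0 ?p)"
    by (simp add: T0_pvec)
  have le: "\<bar>u 0\<bar> \<le> Lnorm ?p u" for u
  proof -
    have "\<bar>u 0\<bar>\<^sup>2 \<le> (\<Sum>j\<in>T0 ?p. \<bar>u j\<bar>\<^sup>2)"
      by (rule member_le_sum[OF z]) (use fin in auto)
    then show ?thesis
      unfolding Lnorm_def by (rule real_le_rsqrt)
  qed
  have "continuous_on {0..1} (\<lambda>t. h t 0)"
    unfolding continuous_on_def
  proof
    fix \<theta> :: real assume "\<theta> \<in> {0..1}"
    then have "((\<lambda>t. Lnorm ?p (h t - h \<theta>)) \<longlongrightarrow> 0) (at \<theta> within {0..1})"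
      using h by (simp add: H0_def)
    then have "((\<lambda>t. h t 0 - h \<theta> 0) \<longlongrightarrow> 0) (at \<theta> within {0..1})"
      by (rule Lim_null_comparison[rotated])
        (use le in \<open>auto intro!: always_eventually simp: fun_diff_def\<close>)
    then show "((\<lambda>t. h t 0) \<longlongrightarrow> h \<theta> 0) (at \<theta> within {0..1})"
      by (simp add: LIM_zero_iff)
  qed
  moreover have "h 0 0 \<le> c" "c \<le> h 1 0"
    using h c by (auto simp: H0_def zero_fun_def fun_diff_def)
  ultimately show ?thesis
    using IVT'[of "\<lambda>t. h t 0" 0 c 1] that by auto
qed

text \<open>By Tychonoff, the configurations in \<open>RB r\<close> with values in an interval form a compact set.\<close>

lemma local_energy_bounded_on_box:
  fixes s :: "'n::finite config \<Rightarrow> real"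
  assumes "continuous_on (RB r) s"
  obtains M where "\<And>u j. (\<And>i. a \<le> u i \<and> u i \<le> b) \<Longrightarrow> \<bar>S_site r s j u\<bar> \<le> M"
proof -
  let ?K = "PiE UNIV (\<lambda>i. if i \<in> Bset r then {a..b} else {undefined}) :: 'n config set"
  have "compactin (product_topology (\<lambda>_. euclidean) UNIV) ?K"
    by (subst compactin_PiE) auto
  then have "compact ?K"
    by (simp add: euclidean_product_topology)
  moreover have "?K \<subseteq> RB r"
    by (auto simp: RB_def PiE_def Pi_def extensional_def split: if_splits)
  ultimately have "bounded (s ` ?K)"
    by (meson assms compact_continuous_image compact_imp_bounded continuous_on_subset)
  then obtain M where M: "\<And>x. x \<in> ?K \<Longrightarrow> \<bar>s x\<bar> \<le> M"
    by (auto simp: bounded_iff)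
  show ?thesis
  proof
    fix u :: "'n config" and j
    assume "\<And>i. a \<le> u i \<and> u i \<le> b"
    then show "\<bar>S_site r s j u\<bar> \<le> M"
      unfolding S_site_def by (intro M) auto
  qed
qed

text \<open>As \<open>\<theta>\<close> runs from \<open>0\<close> to \<open>1\<close>, the positions \<open>0, \<dots>, k-1\<close> of each period are raised from \<open>0\<close> to
  \<open>D\<close> one after the other.\<close>

definition sweep :: "'n::finite \<Rightarrow> nat \<Rightarrow> real \<Rightarrow> real \<Rightarrow> 'n config" where
  "sweep e k D \<theta> = (\<lambda>i. D * max 0 (min 1 (real k * \<theta> - real_of_int (i $ e mod int k))))"

lemma sweep_bounds: "D \<ge> 0 \<Longrightarrow> 0 \<le> sweep e k D \<theta> i \<and> sweep e k D \<theta> i \<le> D"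
  by (auto simp: sweep_def mult_left_le)

lemma sweep_in_H0:
  fixes e :: "'n::finite"
  assumes D: "D \<ge> 0" and k: "k \<ge> 1" and vw: "w0 - v0 = (\<lambda>_. D)"
  shows "sweep e k D \<in> H0 v0 w0 (pvec e k)"
  unfolding H0_def
proof (intro CollectI conjI ballI)
  show "sweep e k D ` {0..1} \<subseteq> G0 v0 w0 (pvec e k)"
  proof clarify
    fix \<theta> :: real
    have "sweep e k D \<theta> \<in> Lambda0 (pvec e k)"
      by (auto simp: Lambda0_def pvec_def sweep_def axis_def)
    then show "sweep e k D \<theta> \<in> G0 v0 w0 (pvec e k)"
      using sweep_bounds[OF D, of e k \<theta>] by (simp add: G0_def vw le_fun_def zero_fun_def)
  qed
  show "((\<lambda>t. Lnorm (pvec e k) (sweep e k D t - sweep e k D \<theta>)) \<longlongrightarrow> 0) (at \<theta> within {0..1})" for \<theta>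
  proof -
    have "((\<lambda>t. Lnorm (pvec e k) (sweep e k D t - sweep e k D \<theta>)) \<longlongrightarrow>
        sqrt (\<Sum>j\<in>T0 (pvec e k). \<bar>sweep e k D \<theta> j - sweep e k D \<theta> j\<bar>\<^sup>2)) (at \<theta> within {0..1})"
      unfolding Lnorm_def sweep_def fun_diff_def by (intro tendsto_intros)
    then show ?thesis
      by simp
  qed
  have "sweep e k D 1 i = D" for i
  proof -
    have "i $ e mod int k < int k"
      using k by simp
    then have "1 \<le> real k * 1 - real_of_int (i $ e mod int k)"
      by linarith
    then show ?thesis
      by (simp add: sweep_def)
  qed
  then show "sweep e k D 1 = w0 - v0"
    by (simp add: vw fun_eq_iff)
  have "sweep e k D 0 i = 0" for i
  proof -
    have "0 \<le> i $ e mod int k"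
      using k by simp
    then have "real k * 0 - real_of_int (i $ e mod int k) \<le> 0"
      by linarith
    then show ?thesis
      by (simp add: sweep_def)
  qed
  then show "sweep e k D 0 = 0"
    by (simp add: zero_fun_def fun_eq_iff)
qed

text \<open>The fronts are at \<open>\<lfloor>k\<theta>\<rfloor>\<close>, where the raising takes place, and at \<open>0 \<equiv> k\<close>, where the period starts
  anew. A window of radius \<open>r\<close> that avoids both sees only one of the two constants.\<close>

lemma sweep_constant_off_fronts:
  fixes e :: "'n::finite"
  assumes "r \<le> n" "n + r < k" "int r < \<bar>int n - \<lfloor>real k * \<theta>\<rfloor>\<bar>"
  shows "S_site r s (axis e (int n)) (sweep e k D \<theta> + (\<lambda>_. a)) \<in> {const_energy r s a, const_energy r s (D + a)}"
proof -
  let ?m = "\<lfloor>real k * \<theta>\<rfloor>"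
  have red: "(axis e (int n) + b) $ e mod int k = int n + b $ e"
    and bd: "\<bar>b $ e\<bar> \<le> int r" if "b \<in> Bset r" for b
  proof -
    show "\<bar>b $ e\<bar> \<le> int r"
      using that nth_le_l1norm[of b e] by (simp add: Bset_def)
    then show "(axis e (int n) + b) $ e mod int k = int n + b $ e"
      using assms(1,2) by (simp add: axis_def)
  qed
  consider "int n < ?m - int r" | "int n > ?m + int r"
    using assms(3) by linarith
  then show ?thesis
  proof cases
    case 1
    have "sweep e k D \<theta> (axis e (int n) + b) = D" if "b \<in> Bset r" for b
    proof -
      have "real_of_int (int n + b $ e) + 1 \<le> real k * \<theta>"
        using 1 bd[OF that] by linarith
      then show ?thesis
        unfolding sweep_def red[OF that] by simp
    qed
    then have "S_site r s (axis e (int n)) (sweep e k D \<theta> + (\<lambda>_. a)) = const_energy r s (D + a)"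
      unfolding S_site_def const_energy_def by (auto intro!: arg_cong[where f = s])
    then show ?thesis
      by simp
  next
    case 2
    have "sweep e k D \<theta> (axis e (int n) + b) = 0" if "b \<in> Bset r" for b
    proof -
      have "real k * \<theta> \<le> real_of_int (int n + b $ e)"
        using 2 bd[OF that] by linarith
      then show ?thesis
        unfolding sweep_def red[OF that] by simp
    qed
    then have "S_site r s (axis e (int n)) (sweep e k D \<theta> + (\<lambda>_. a)) = const_energy r s a"
      unfolding S_site_def const_energy_def by (auto intro!: arg_cong[where f = s])
    then show ?thesis
      by simp
  qed
qed

lemma J0_sweep_le:
  fixes e :: "'n::finite"
  assumes D: "D \<ge> 0"
    and M: "\<And>u j. (\<And>i. a \<le> u i \<and> u i \<le> D + a) \<Longrightarrow> \<bar>S_site r s j u\<bar> \<le> M"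
    and min: "const_energy r s a = c" "const_energy r s (D + a) = c"
  shows "J0 r s (pvec e k) (sweep e k D \<theta> + (\<lambda>_. a)) \<le> real k * c + real (4 * r + 1) * (M - c)"
proof -
  define m where "m = \<lfloor>real k * \<theta>\<rfloor>"
  define f where "f n = S_site r s (axis e (int n)) (sweep e k D \<theta> + (\<lambda>_. a))" for n
  (* The sites whose window can meet one of the two fronts. *)
  define bad where "bad = {..<r} \<union> {k - r..<k} \<union> nat ` {m - int r..m + int r}"
  have fin: "finite bad"
    by (simp add: bad_def)
  have "card (nat ` {m - int r..m + int r}) \<le> 2 * r + 1"
    using card_image_le[of "{m - int r..m + int r}" nat] by simp
  moreover have "card bad \<le> card {..<r} + card {k - r..<k} + card (nat ` {m - int r..m + int r})"
    unfolding bad_def by (meson add_le_mono1 card_Un_le le_trans)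
  ultimately have card: "card bad \<le> 4 * r + 1"
    by simp
  have fM: "f n \<le> M" for n
  proof -
    have "\<bar>f n\<bar> \<le> M"
      unfolding f_def using sweep_bounds[OF D, of e k \<theta>] by (intro M) simp
    then show ?thesis
      by simp
  qed
  have "\<bar>const_energy r s a\<bar> \<le> M"
    unfolding const_energy_def using D by (intro M) simp
  then have cM: "c \<le> M"
    using min by simp
  have good: "f n = c" if "n < k" "n \<notin> bad" for n
  proof -
    have "int n \<notin> {m - int r..m + int r}"
      using that(2) unfolding bad_def by (metis UnI2 image_eqI nat_int)
    then have "int r < \<bar>int n - m\<bar>"
      by auto
    moreover have "r \<le> n" "n + r < k"
      using that by (auto simp: bad_def)
    ultimately show ?thesis
      using sweep_constant_off_fronts[of r n k \<theta> s e D a] min by (auto simp: f_def m_def)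
  qed
  have "(\<Sum>n<k. f n - c) = (\<Sum>n\<in>{..<k} \<inter> bad. f n - c)"
    by (rule sum.mono_neutral_right) (use good in auto)
  also have "\<dots> \<le> (\<Sum>n\<in>{..<k} \<inter> bad. M - c)"
    by (rule sum_mono) (simp add: fM)
  also have "\<dots> \<le> real (4 * r + 1) * (M - c)"
  proof -
    have "card ({..<k} \<inter> bad) \<le> 4 * r + 1"
      using card card_mono[OF fin, of "{..<k} \<inter> bad"] by simp
    then show ?thesis
      using cM by (simp add: mult_right_mono)
  qed
  finally show ?thesis
    by (simp add: J0_pvec f_def sum_subtractf)
qed

theorem theorem3p13:
  fixes r :: nat
    and first :: "'n::finite"
    and s :: "(int ^ 'n \<Rightarrow> real) \<Rightarrow> real"
    and v0 w0 :: "int ^ 'n \<Rightarrow> real"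
    and ustar :: "nat \<Rightarrow> int ^ 'n \<Rightarrow> real"
  assumes "r \<ge> 1"
    and "Ck_on_RB r 2 s"
    and "shift_invariant r s"
    and "coercive r s"
    and "twist_condition r s"
    and "bounded_second_partials r s"
    and "v0 \<in> M0 r s" and "w0 \<in> M0 r s"
    and "pointwise_less v0 w0"
    and "\<not> (\<exists>u\<in>M0 r s. pointwise_less v0 u \<and> pointwise_less u w0)"
    and "\<And>k. k \<ge> 1 \<Longrightarrow> ustar k \<in> G0 v0 w0 (pvec first k)"
    and "\<And>k. k \<ge> 1 \<Longrightarrow> critical_point (pvec first k) (I0 r s v0 (pvec first k)) (ustar k)"
    and "\<And>k. k \<ge> 1 \<Longrightarrow> I0 r s v0 (pvec first k) (ustar k) = d0 r s v0 w0 (pvec first k)"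
  shows "infinite {ustar k | k. k \<ge> 1}"
proof
  assume finite: "finite {ustar k | k. k \<ge> 1}"
  note C2 = assms(2) and co = assms(4) and tw = assms(5) and v0 = assms(7) and w0 = assms(8)
    and lt = assms(9) and adj = assms(10) and us = assms(11) and dk = assms(13)
  let ?p = "pvec first" and ?c = "c0 r s"
  obtain a b where a: "v0 = (\<lambda>_. a)" and b: "w0 = (\<lambda>_. b)"
    using v0 w0 by (auto simp: M0_def constants_def)
  define D where "D = b - a"
  have D: "D > 0"
    using lt by (simp add: pointwise_less_def a b D_def)
  have vw: "w0 - v0 = (\<lambda>_. D)" and Da: "D + a = b"
    by (simp_all add: a b D_def fun_diff_def)
  have min: "const_energy r s a = ?c" "const_energy r s (D + a) = ?c"
    using v0 w0 by (simp_all add: M0_def const_energy_def a b Da)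
  define \<delta> where "\<delta> = const_energy r s (D / 2 + a) - ?c"
  have \<delta>: "\<delta> > 0"
  proof -
    have "(\<lambda>_. D / 2 + a) \<notin> M0 r s"
    proof
      assume "(\<lambda>_. D / 2 + a) \<in> M0 r s"
      moreover have "a < D / 2 + a" "D / 2 + a < b"
        using D by (simp_all add: D_def field_simps)
      ultimately show False
        using adj by (auto simp: pointwise_less_def a b)
    qed
    then have "const_energy r s (D / 2 + a) \<noteq> ?c"
      by (auto simp: M0_def constants_def const_energy_def)
    then show ?thesis
      using c0_le_const_energy[OF co, of "D / 2 + a"] by (simp add: \<delta>_def)
  qed
  have "continuous_on (RB r) s"
    using C2 by (simp add: numeral_2_eq_2)
  then obtain M where M: "\<And>u j. (\<And>i. a \<le> u i \<and> u i \<le> D + a) \<Longrightarrow> \<bar>S_site r s j u\<bar> \<le> M"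
    using local_energy_bounded_on_box[of r s a "D + a"] by blast
  define C where "C = real (4 * r + 1) * (M - ?c)"
  have per: "u + v0 \<in> Lambda0 (?p k)" if "u \<in> G0 v0 w0 (?p k)" for u k
    using that by (simp add: G0_def Lambda0_def a)
  have bdd: "bdd_above ((\<lambda>\<theta>. I0 r s v0 (?p k) (h \<theta>)) ` {0..1})" if h: "h \<in> H0 v0 w0 (?p k)" for h k
  proof (rule bdd_aboveI2)
    fix \<theta> :: real assume "\<theta> \<in> {0..1}"
    then have "h \<theta> \<in> G0 v0 w0 (?p k)"
      using h by (auto simp: H0_def)
    then have "0 \<le> h \<theta> i \<and> h \<theta> i \<le> D" for i
      by (simp add: G0_def vw le_fun_def)
    then have "S_site r s j (h \<theta> + v0) \<le> M" for j
      by (intro abs_le_D1[OF M]) (simp add: a)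
    then show "I0 r s v0 (?p k) (h \<theta>) \<le> real k * M"
      unfolding I0_def J0_pvec by (metis (no_types, lifting) card_lessThan sum_bounded_above)
  qed
  have low: "real k * ?c + \<delta> \<le> (SUP \<theta>\<in>{0..1}. I0 r s v0 (?p k) (h \<theta>))"
    if k: "k \<ge> 1" and h: "h \<in> H0 v0 w0 (?p k)" for h k
  proof -
    obtain \<theta> where \<theta>: "\<theta> \<in> {0..1}" "h \<theta> 0 = D / 2"
      using path_crosses_level[OF h k, of "D / 2"] D by (auto simp: a b D_def)
    then have "h \<theta> + v0 \<in> Lambda0 (?p k)"
      using h by (intro per) (auto simp: H0_def)
    from J0_ge_const_energy_at_0[OF C2 tw co this k]
    have "real k * ?c + \<delta> \<le> I0 r s v0 (?p k) (h \<theta>)"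
      using \<theta> by (simp add: I0_def \<delta>_def a)
    also have "\<dots> \<le> (SUP \<theta>\<in>{0..1}. I0 r s v0 (?p k) (h \<theta>))"
      by (rule cSUP_upper[OF \<theta>(1) bdd[OF h]])
    finally show ?thesis .
  qed
  have sw: "sweep first k D \<in> H0 v0 w0 (?p k)" if "k \<ge> 1" for k
    using D that vw by (intro sweep_in_H0) auto
  have d_low: "real k * ?c + \<delta> \<le> d0 r s v0 w0 (?p k)" if "k \<ge> 1" for k
    unfolding d0_def using low[OF that] sw[OF that] by (intro cINF_greatest) auto
  have d_upp: "d0 r s v0 w0 (?p k) \<le> real k * ?c + C" if k: "k \<ge> 1" for k
  proof -
    have "d0 r s v0 w0 (?p k) \<le> (SUP \<theta>\<in>{0..1}. I0 r s v0 (?p k) (sweep first k D \<theta>))"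
      unfolding d0_def by (rule cINF_lower[OF bdd_belowI2[OF low[OF k]] sw[OF k]])
    also have "\<dots> \<le> real k * ?c + C"
      using J0_sweep_le[OF less_imp_le[OF D] M min] by (intro cSUP_least) (auto simp: I0_def a C_def)
    finally show ?thesis .
  qed
  have "{ustar k | k. k \<ge> 1} = ustar ` {1..}"
    by auto
  then obtain l where l: "l \<ge> 1" and inf: "infinite {k \<in> {1..}. ustar k = ustar l}"
    using pigeonhole_infinite[of "{1::nat..}" ustar] finite infinite_Ici by auto
  (* The excess of d over the minimal energy is at least k * \<delta> / l and at most C. *)
  have "k \<le> nat \<lceil>real l * C / \<delta>\<rceil>" if k: "k \<ge> 1" "ustar k = ustar l" for k
  proof -
    let ?w = "ustar l + v0"
    have "?w \<in> Lambda0 (?p k)" "?w \<in> Lambda0 (?p l)"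
      using us[OF k(1)] us[OF l] k(2) per by auto
    then have "real l * J0 r s (?p k) ?w = real k * J0 r s (?p l) ?w"
      using J0_pvec_multiple[of ?w first k r s l] J0_pvec_multiple[of ?w first l r s k]
      by (simp add: mult.commute)
    then have eq: "real l * d0 r s v0 w0 (?p k) = real k * d0 r s v0 w0 (?p l)"
      using dk[OF k(1)] dk[OF l] k(2) by (simp add: I0_def)
    have "real k * (real l * ?c + \<delta>) \<le> real k * d0 r s v0 w0 (?p l)"
      using d_low[OF l] by (simp add: mult_left_mono)
    also have "\<dots> \<le> real l * (real k * ?c + C)"
      unfolding eq[symmetric] using d_upp[OF k(1)] by (simp add: mult_left_mono)
    finally have "real k * \<delta> \<le> real l * C"
      by (simp add: algebra_simps)
    then have "real k \<le> real l * C / \<delta>"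
      using \<delta> by (simp add: pos_le_divide_eq)
    then show ?thesis
      by linarith
  qed
  then have "{k \<in> {1..}. ustar k = ustar l} \<subseteq> {..nat \<lceil>real l * C / \<delta>\<rceil>}"
    by auto
  then show False
    using inf finite_subset by blast
qed

end
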